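(* Let $k$ be a positive integer. Every weighted graph $G=(V,E,w)$ with maximum degree $\Delta(G)\le k$ has a bisection of weight at least \[\frac{k+2}{2(k+1)}\,w(G).\] (In particular, this holds whenever $k$ is even.)
   Context: Graphs are finite and simple. A weighted graph $G=(V,E,w)$ is a graph with a weight function $w:E\to\mathbb{R}_{\ge 0}$; $w(G)=\sum_{e\in E}w(e)$. A bisection of $G$ is a partition $(X,Y)$ of $V$ with $\big||X|-|Y|\big|\le 1$ (for a one-vertex graph one part is empty), and its weight is the total weight of the edges with one endpoint in $X$ and the other in $Y$. *)

theory Defs
  imports Complex_Main
begin

locale simple_graph =
  fixes V :: "'a set" and E :: "'a set set"
  assumes finite_vertices: "finite V"
    and edges: "\<And>e. e \<in> E \<Longrightarrow> e \<subseteq> V \<and> card e = 2"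

(* The weight function is total on sets; only its values on E are constrained or used. *)
locale weighted_graph = simple_graph V E
  for V :: "'a set" and E :: "'a set set" +
  fixes w :: "'a set \<Rightarrow> real"
  assumes weight_nonneg: "\<And>e. e \<in> E \<Longrightarrow> 0 \<le> w e"

definition total_weight :: "'a set set \<Rightarrow> ('a set \<Rightarrow> real) \<Rightarrow> real" where
  "total_weight E w = (\<Sum>e\<in>E. w e)"

definition degree :: "'a set set \<Rightarrow> 'a \<Rightarrow> nat" where
  "degree E v = card {e \<in> E. v \<in> e}"

(* Inserting 0 only matters for the graph without vertices, whose maximum degree is 0. *)
definition max_degree :: "'a set \<Rightarrow> 'a set set \<Rightarrow> nat" where
  "max_degree V E = Max (insert 0 (degree E ` V))"

(* Parts may be empty, but the balance condition allows this only if V has at most one vertex. *)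
definition bisection :: "'a set \<Rightarrow> 'a set \<Rightarrow> 'a set \<Rightarrow> bool" where
  "bisection V X Y \<longleftrightarrow>
     X \<union> Y = V \<and> X \<inter> Y = {} \<and> \<bar>int (card X) - int (card Y)\<bar> \<le> 1"

definition cut_edges :: "'a set set \<Rightarrow> 'a set \<Rightarrow> 'a set \<Rightarrow> 'a set set" where
  "cut_edges E X Y = {e \<in> E. \<exists>x\<in>X. \<exists>y\<in>Y. e = {x, y}}"

definition bisection_weight ::
    "'a set set \<Rightarrow> ('a set \<Rightarrow> real) \<Rightarrow> 'a set \<Rightarrow> 'a set \<Rightarrow> real" where
  "bisection_weight E w X Y = (\<Sum>e\<in>cut_edges E X Y. w e)"

end

theory Submission
  imports Defs "HOL-Combinatorics.Transposition"
begin

text \<open>By Vizing's theorem the edges split into \<open>k + 1\<close> matchings, one of which, \<open>M\<close>, has weight at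
  least \<open>w(G) / (k + 1)\<close>. Pair up the vertices so that every edge of \<open>M\<close> is a pair, and put the two
  vertices of each pair on opposite sides. If the sides are chosen at random, the edges of \<open>M\<close> are
  always cut and every other edge is cut with probability at least \<open>1/2\<close>, so that some choice cuts
  weight at least \<open>(w(G) + w(M)) / 2\<close>. The choices are made greedily below instead of at random.

  Vizing's theorem is proved by adding one edge at a time: a maximal fan at one end of the new edge
  is rotated, if necessary after swapping two colours along a Kempe chain.\<close>

section \<open>Proper edge colourings and the rotation of fans\<close>

definition missing :: "'a set set \<Rightarrow> ('a set \<Rightarrow> 'c) \<Rightarrow> 'a \<Rightarrow> 'c \<Rightarrow> bool" where
  "missing F c x i \<longleftrightarrow> (\<forall>e\<in>F. x \<in> e \<longrightarrow> c e \<noteq> i)"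

definition edge_colouring :: "'a set set \<Rightarrow> 'c set \<Rightarrow> ('a set \<Rightarrow> 'c) \<Rightarrow> bool" where
  "edge_colouring F C c \<longleftrightarrow>
     c ` F \<subseteq> C \<and> (\<forall>e\<in>F. \<forall>f\<in>F. \<forall>x. x \<in> e \<and> x \<in> f \<and> c e = c f \<longrightarrow> e = f)"

lemma edge_colouringD:
  assumes "edge_colouring F C c" "e \<in> F" "f \<in> F" "x \<in> e" "x \<in> f" "c e = c f"
  shows "e = f"
  using assms unfolding edge_colouring_def by blast

lemma edge_colouring_insert:
  assumes col: "edge_colouring F C c" and "i \<in> C"
    and "missing F c u i" and "missing F c v i"
  shows "edge_colouring (insert {u, v} F) C (c({u, v} := i))"
  using assms unfolding edge_colouring_def missing_def
  by (auto simp: image_subset_iff)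

lemma edge_colouring_subset:
  "edge_colouring F C c \<Longrightarrow> G \<subseteq> F \<Longrightarrow> edge_colouring G C c"
  unfolding edge_colouring_def by blast

text \<open>Induction along the fan: \<open>{u, v}\<close> takes the colour of
  \<open>{u, y}\<close>, which \<open>v\<close> misses, and \<open>{u, y}\<close> becomes the
  uncoloured edge of a shorter fan. The last edge receives \<open>b\<close>, missing at both of its
  ends.\<close>

lemma edge_colouring_rotate_fan:
  assumes "edge_colouring (H - {{u, v}}) C c"
    and "distinct (v # vs)" and "u \<notin> set (v # vs)"
    and "\<forall>x\<in>set (v # vs). {u, x} \<in> H"
    and "successively (\<lambda>x y. missing (H - {{u, v}}) c x (c {u, y})) (v # vs)"
    and "b \<in> C" and "missing (H - {{u, v}}) c u b"
    and "missing (H - {{u, v}}) c (last (v # vs)) b"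
  shows "\<exists>c'. edge_colouring H C c'"
  using assms
proof (induction vs arbitrary: v c)
  case Nil
  then have "edge_colouring (insert {u, v} (H - {{u, v}})) C (c({u, v} := b))"
    by (intro edge_colouring_insert) auto
  moreover have "insert {u, v} (H - {{u, v}}) = H"
    using Nil by auto
  ultimately show ?case by metis
next
  case (Cons y vs)
  let ?F = "H - {{u, v}}" and ?c = "c({u, v} := c {u, y})"
  have neq: "{u, y} \<noteq> {u, v}" and uyF: "{u, y} \<in> ?F"
    using Cons.prems(2-4) by (auto simp: doubleton_eq_iff)
  \<comment> \<open>A remaining fan vertex is neither \<open>u\<close> nor \<open>v\<close>, so the
    recoloured edge \<open>{u, v}\<close> does not meet it.\<close>
  have old: "e \<in> ?F \<and> ?c e = c e" if "e \<in> H - {{u, y}}" "x \<in> e" "x \<in> set (y # vs)" for e x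
    using that Cons.prems(2,3) by auto
  have missing_fan: "missing (H - {{u, y}}) ?c x i"
    if "missing ?F c x i" "x \<in> set (y # vs)" for x i
    using that old unfolding missing_def by metis
  have uy_only: "e = {u, y}" if "e \<in> ?F" "u \<in> e" "c e = c {u, y}" for e
    using edge_colouringD[OF Cons.prems(1) that(1) uyF, of u] that by auto
  have "edge_colouring (insert {u, v} (?F - {{u, y}})) C ?c"
  proof (rule edge_colouring_insert)
    show "edge_colouring (?F - {{u, y}}) C c"
      using Cons.prems(1) by (rule edge_colouring_subset) auto
    show "c {u, y} \<in> C"
      using Cons.prems(1) uyF unfolding edge_colouring_def by blast
    show "missing (?F - {{u, y}}) c u (c {u, y})"
      unfolding missing_def using uy_only by blast
    show "missing (?F - {{u, y}}) c v (c {u, y})"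
      using Cons.prems(5) unfolding missing_def by auto
  qed
  moreover have "insert {u, v} (?F - {{u, y}}) = H - {{u, y}}"
    using Cons.prems(4) neq by auto
  ultimately have col: "edge_colouring (H - {{u, y}}) C ?c" by simp
  show ?case
  proof (rule Cons.IH[OF col])
    have "successively (\<lambda>x z. missing ?F c x (c {u, z})) (y # vs)"
      using Cons.prems(5) by simp
    then show "successively (\<lambda>x z. missing (H - {{u, y}}) ?c x (?c {u, z})) (y # vs)"
    proof (rule successively_mono)
      fix x z
      assume xz: "x \<in> set (y # vs)" "z \<in> set (y # vs)" and m: "missing ?F c x (c {u, z})"
      have "?c {u, z} = c {u, z}"
        using xz Cons.prems(2) by (auto simp: doubleton_eq_iff)
      then show "missing (H - {{u, y}}) ?c x (?c {u, z})"
        using missing_fan[OF m xz(1)] by simp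
    qed
    \<comment> \<open>The colour given to \<open>{u, v}\<close> was already present at
      \<open>u\<close>, on \<open>{u, y}\<close>, and hence differs from \<open>b\<close>.\<close>
    show "missing (H - {{u, y}}) ?c u b"
      using Cons.prems(7) uyF unfolding missing_def by auto
    show "missing (H - {{u, y}}) ?c (last (y # vs)) b"
      using Cons.prems(8) by (intro missing_fan) auto
  qed (use Cons.prems in auto)
qed

section \<open>Kempe chains as orbits of two involutions\<close>

text \<open>The orbit of a point fixed by one of two involutions is a path, whose two ends account for
  all fixed points; a point fixed by both involutions is a path of length zero and counts twice.\<close>

lemma involutions_orbit:
  assumes "finite V" and "x \<in> V" and "B x = x"
    and "\<And>z. z \<in> V \<Longrightarrow> A z \<in> V \<and> A (A z) = z"
    and "\<And>z. z \<in> V \<Longrightarrow> B z \<in> V \<and> B (B z) = z"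
  shows "\<exists>S\<subseteq>V. x \<in> S \<and> A ` S \<subseteq> S \<and> B ` S \<subseteq> S \<and>
           card {z\<in>S. A z = z} + card {z\<in>S. B z = z} = 2"
  using assms
proof (induction "card V" arbitrary: V x A B rule: less_induct)
  case less
  show ?case
  proof (cases "A x = x")
    case True
    then have "{z\<in>{x}. A z = z} = {x}" "{z\<in>{x}. B z = z} = {x}"
      using less.prems by auto
    then show ?thesis
      using True less.prems by (intro exI[of _ "{x}"]) auto
  next
    case False
    define y where "y = A x"
    have y: "y \<in> V" "y \<noteq> x" "A y = x" "A x = y"
      using less.prems(2,4) False unfolding y_def by auto
    \<comment> \<open>Deleting \<open>x\<close> makes its neighbour \<open>y\<close> an end of the
      remaining path. As \<open>y\<close> is now fixed by \<open>A'\<close>, the induction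
      hypothesis is applied with the two involutions exchanged.\<close>
    define A' where "A' = A(y := y)"
    have A': "A' z \<in> V - {x} \<and> A' (A' z) = z" if "z \<in> V - {x}" for z
      using that y less.prems(4)[of z] unfolding A'_def by auto
    have B': "B z \<in> V - {x} \<and> B (B z) = z" if "z \<in> V - {x}" for z
      using that less.prems(3) less.prems(5)[of z] by auto
    have "\<exists>S\<subseteq>V - {x}. y \<in> S \<and> B ` S \<subseteq> S \<and> A' ` S \<subseteq> S \<and>
        card {z\<in>S. B z = z} + card {z\<in>S. A' z = z} = 2"
    proof (rule less.hyps)
      show "card (V - {x}) < card V"
        using less.prems(1,2) by (rule card_Diff1_less)
    qed (use less.prems(1) y A' B' in \<open>auto simp: A'_def\<close>)
    then obtain S where S: "S \<subseteq> V - {x}" "y \<in> S" "B ` S \<subseteq> S" "A' ` S \<subseteq> S"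
      "card {z\<in>S. B z = z} + card {z\<in>S. A' z = z} = 2" by blast
    have fin: "finite S" using S(1) less.prems(1) finite_subset by blast
    \<comment> \<open>Putting \<open>x\<close> back loses the end \<open>y\<close>, which
      \<open>A\<close> moves, and gains the end \<open>x\<close>, which \<open>B\<close> fixes; the
      count stays 2.\<close>
    have "{z\<in>S. A' z = z} = insert y {z\<in>insert x S. A z = z}"
      using S(2) y unfolding A'_def by auto
    then have cA: "card {z\<in>S. A' z = z} = Suc (card {z\<in>insert x S. A z = z})"
      using fin y by simp
    have "{z\<in>insert x S. B z = z} = insert x {z\<in>S. B z = z}"
      using less.prems(3) by auto
    moreover have "x \<notin> S" using S(1) by auto
    ultimately have cB: "card {z\<in>insert x S. B z = z} = Suc (card {z\<in>S. B z = z})"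
      using fin by simp
    have "A z \<in> insert x S" if "z \<in> insert x S" for z
      using that S(2,4) y unfolding A'_def by (cases "z = y") auto
    moreover have "B ` insert x S \<subseteq> insert x S"
      using S(3) less.prems(3) by auto
    ultimately show ?thesis
      using S(1,5) cA cB less.prems(2) by (intro exI[of _ "insert x S"]) auto
  qed
qed

text \<open>Sending a vertex without an edge of colour \<open>i\<close> to itself makes this, for a
  proper colouring, an involution on the vertices, as \<open>involutions_orbit\<close>
  requires.\<close>

definition partner :: "'a set set \<Rightarrow> ('a set \<Rightarrow> 'c) \<Rightarrow> 'c \<Rightarrow> 'a \<Rightarrow> 'a" where
  "partner F c i x = (if missing F c x i then x else (SOME y. {x, y} \<in> F \<and> c {x, y} = i))"

lemma (in simple_graph) edgeE:
  assumes "e \<in> E" "x \<in> e"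
  obtains y where "e = {x, y}" "x \<noteq> y" "x \<in> V" "y \<in> V"
proof -
  have "card e = 2" "e \<subseteq> V" using edges assms by auto
  then obtain p q where "e = {p, q}" "p \<noteq> q" by (auto simp: card_2_iff)
  then show thesis using that \<open>e \<subseteq> V\<close> assms(2) by (cases "x = p") (auto simp: insert_commute)
qed

context simple_graph
begin

lemma finite_edges: "finite E"
  by (rule finite_subset[of _ "Pow V"]) (use edges finite_vertices in auto)

lemma subgraph: "F \<subseteq> E \<Longrightarrow> simple_graph V F"
  using finite_vertices edges unfolding simple_graph_def by auto

lemma partner_edge:
  assumes "\<not> missing E c x i"
  shows "{x, partner E c i x} \<in> E \<and> c {x, partner E c i x} = i"
proof -
  obtain e where e: "e \<in> E" "x \<in> e" "c e = i"
    using assms unfolding missing_def by blast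
  obtain y where "e = {x, y}" using edgeE[OF e(1,2)] .
  then have "\<exists>y. {x, y} \<in> E \<and> c {x, y} = i" using e by blast
  from someI_ex[OF this] show ?thesis using assms unfolding partner_def by simp
qed

lemma partner_eqI:
  assumes col: "edge_colouring E C c" and e: "{x, y} \<in> E" "c {x, y} = i"
  shows "partner E c i x = y"
proof -
  have "\<not> missing E c x i" using e unfolding missing_def by blast
  note p = partner_edge[OF this]
  have "{x, y} = {x, partner E c i x}"
    by (rule edge_colouringD[OF col, of _ _ x]) (use e p in auto)
  then show ?thesis by (auto simp: doubleton_eq_iff)
qed

text \<open>There are no loops, so the other end of an edge at \<open>x\<close> is never
  \<open>x\<close> itself.\<close>

lemma partner_fixed_iff: "partner E c i x = x \<longleftrightarrow> missing E c x i"
  using partner_edge[of c x i] edges[of "{x}"] by (auto simp: partner_def)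

lemma partner_involution:
  assumes col: "edge_colouring E C c" and "x \<in> V"
  shows "partner E c i x \<in> V \<and> partner E c i (partner E c i x) = x"
proof (cases "missing E c x i")
  case True
  then show ?thesis using assms(2) by (simp add: partner_def)
next
  case False
  let ?y = "partner E c i x"
  have e: "{x, ?y} \<in> E" "c {x, ?y} = i" using partner_edge[OF False] by auto
  then have "?y \<in> V" using edges by blast
  moreover have "partner E c i ?y = x"
    by (rule partner_eqI[OF col]) (use e in \<open>auto simp: insert_commute\<close>)
  ultimately show ?thesis by simp
qed

text \<open>The set \<open>S\<close> is the vertex set of the two-coloured Kempe chain through \<open>u\<close>.\<close>

lemma kempe_chain:
  assumes col: "edge_colouring E C c" and "u \<in> V" and "missing E c u a"
    and b: "missing E c p b" "missing E c q b" "p \<noteq> q"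
  obtains S where "u \<in> S" and "p \<notin> S \<or> q \<notin> S"
    and "\<forall>e\<in>E. c e \<in> {a, b} \<longrightarrow> e \<subseteq> S \<or> e \<inter> S = {}"
proof -
  let ?A = "partner E c a" and ?B = "partner E c b"
  \<comment> \<open>Since \<open>u\<close> misses \<open>a\<close>, it is fixed by
    \<open>?A\<close>, which therefore takes the role of the second involution.\<close>
  have "\<exists>S\<subseteq>V. u \<in> S \<and> ?B ` S \<subseteq> S \<and> ?A ` S \<subseteq> S \<and>
      card {z\<in>S. ?B z = z} + card {z\<in>S. ?A z = z} = 2"
    using assms finite_vertices partner_involution[OF col]
    by (intro involutions_orbit) (auto simp: partner_fixed_iff)
  then obtain S where S: "S \<subseteq> V" "u \<in> S" "?B ` S \<subseteq> S" "?A ` S \<subseteq> S"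
    "card {z\<in>S. ?B z = z} + card {z\<in>S. ?A z = z} = 2" by blast
  have fin: "finite S" using S(1) finite_vertices finite_subset by blast
  show thesis
  proof (rule that[OF S(2)])
    \<comment> \<open>One of the two ends of the chain is \<open>u\<close> itself, counted for
      colour \<open>a\<close>; at most one is left for a vertex missing \<open>b\<close>.\<close>
    have "card {u} \<le> card {z\<in>S. ?A z = z}"
      using fin S(2) assms(3) by (intro card_mono) (auto simp: partner_fixed_iff)
    then have "card {z\<in>S. ?B z = z} < card {p, q}"
      using S(5) b(3) by simp
    then have "\<not> {p, q} \<subseteq> {z\<in>S. ?B z = z}"
      using card_mono[of "{z\<in>S. ?B z = z}" "{p, q}"] fin by auto
    then show "p \<notin> S \<or> q \<notin> S" using b by (auto simp: partner_fixed_iff)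
  next
    have "e \<subseteq> S \<or> e \<inter> S = {}" if e: "e \<in> E" "c e \<in> {a, b}" for e
    proof -
      have "e \<subseteq> S" if z: "z \<in> e" "z \<in> S" for z
      proof -
        obtain y where y: "e = {z, y}" using edgeE[OF e(1) z(1)] .
        have "partner E c (c e) z = y"
          by (rule partner_eqI[OF col]) (use e y in auto)
        then have "y \<in> S" using e(2) z(2) S(3,4) by auto
        then show "e \<subseteq> S" using y z by simp
      qed
      then show ?thesis by blast
    qed
    then show "\<forall>e\<in>E. c e \<in> {a, b} \<longrightarrow> e \<subseteq> S \<or> e \<inter> S = {}" by blast
  qed
qed

end

section \<open>Swapping two colours along a Kempe chain\<close>

definition swap_colours :: "'a set \<Rightarrow> 'c \<Rightarrow> 'c \<Rightarrow> ('a set \<Rightarrow> 'c) \<Rightarrow> 'a set \<Rightarrow> 'c" where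
  "swap_colours S a b c e = (if e \<subseteq> S then transpose a b (c e) else c e)"

text \<open>Edges coloured \<open>a\<close> or \<open>b\<close> do not cross the boundary of
  \<open>S\<close>, and the transposition fixes all other colours. Hence all edges at
  \<open>x\<close> undergo the same permutation of colours, which is why properness and missing
  colours carry over.\<close>

lemma swap_colours_at:
  assumes closed: "\<forall>e\<in>F. c e \<in> {a, b} \<longrightarrow> e \<subseteq> S \<or> e \<inter> S = {}"
    and "e \<in> F" "x \<in> e"
  shows "swap_colours S a b c e = (if x \<in> S then transpose a b (c e) else c e)"
  using closed assms(2,3) unfolding swap_colours_def
  by (cases "c e = a \<or> c e = b") (auto simp: transpose_def)

lemma edge_colouring_swap:
  assumes closed: "\<forall>e\<in>F. c e \<in> {a, b} \<longrightarrow> e \<subseteq> S \<or> e \<inter> S = {}"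
    and col: "edge_colouring F C c" and "a \<in> C" "b \<in> C"
  shows "edge_colouring F C (swap_colours S a b c)"
  unfolding edge_colouring_def
proof (intro conjI ballI allI impI)
  show "swap_colours S a b c ` F \<subseteq> C"
    using assms(2-) unfolding edge_colouring_def swap_colours_def transpose_def by auto
next
  fix e f x
  assume ef: "e \<in> F" "f \<in> F"
    and x: "x \<in> e \<and> x \<in> f \<and> swap_colours S a b c e = swap_colours S a b c f"
  have "c e = c f"
    using x swap_colours_at[OF closed ef(1), of x]
      swap_colours_at[OF closed ef(2), of x]
    by (auto split: if_splits dest: injD[OF inj_transpose])
  then show "e = f" using edge_colouringD[OF col ef] x by blast
qed

lemma missing_swap:
  assumes closed: "\<forall>e\<in>F. c e \<in> {a, b} \<longrightarrow> e \<subseteq> S \<or> e \<inter> S = {}"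
    and "missing F c x i"
  shows "missing F (swap_colours S a b c) x (if x \<in> S then transpose a b i else i)"
  unfolding missing_def
proof (intro ballI impI)
  fix e assume e: "e \<in> F" "x \<in> e"
  then have "c e \<noteq> i" using assms(2) unfolding missing_def by blast
  then show "swap_colours S a b c e \<noteq> (if x \<in> S then transpose a b i else i)"
    using swap_colours_at[OF closed e]
    by (auto dest: injD[OF inj_transpose])
qed

section \<open>Vizing's theorem\<close>

lemma ex_missing:
  assumes "finite C" "finite F" "degree F x < card C"
  obtains i where "i \<in> C" "missing F c x i"
proof -
  have fin: "finite {e\<in>F. x \<in> e}" using assms(2) by simp
  have "card (c ` {e\<in>F. x \<in> e}) < card C"
    using card_image_le[OF fin, of c] assms(3) unfolding degree_def by linarith
  then have "\<not> C \<subseteq> c ` {e\<in>F. x \<in> e}"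
    using card_mono[OF finite_imageI[OF fin], of C c] by linarith
  then show thesis using that unfolding missing_def by blast
qed

lemma degree_mono: "finite E \<Longrightarrow> F \<subseteq> E \<Longrightarrow> degree F x \<le> degree E x"
  unfolding degree_def by (intro card_mono) auto

text \<open>Every vertex misses some colour. Let \<open>b\<close> be missing at the last vertex of a
  maximal fan. If \<open>u\<close> misses \<open>b\<close> too, the fan can be rotated; otherwise
  maximality puts the edge of colour \<open>b\<close> at \<open>u\<close> into the fan, and a Kempe
  swap frees \<open>b\<close> at \<open>u\<close>.\<close>

lemma (in simple_graph) edge_colouring_extend:
  assumes "finite C" and deg: "\<And>x. x \<in> V \<Longrightarrow> degree E x < card C"
    and uv: "{u, v} \<in> E" and col: "edge_colouring (E - {{u, v}}) C c"
  shows "\<exists>c'. edge_colouring E C c'"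
proof -
  define F where "F = E - {{u, v}}"
  interpret F: simple_graph V F unfolding F_def by (rule subgraph) auto
  note col = col[folded F_def]
  have "u \<in> V" "v \<in> V" "u \<noteq> v" using edges[OF uv] by auto
  have miss: "\<exists>i\<in>C. missing F c x i" if "x \<in> V" for x
  proof -
    have "degree F x < card C"
      using degree_mono[OF finite_edges, of F x] deg[OF that] unfolding F_def by auto
    then show ?thesis using ex_missing[OF assms(1) F.finite_edges] by metis
  qed
  define fan where "fan vs \<longleftrightarrow> distinct (v # vs) \<and> u \<notin> set (v # vs) \<and>
    (\<forall>x\<in>set (v # vs). {u, x} \<in> E) \<and> successively (\<lambda>x y. missing F c x (c {u, y})) (v # vs)" for vs
  \<comment> \<open>Fan vertices are distinct, so lengths are bounded and a longest fan
    exists.\<close>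
  have fan_len: "length vs \<le> card V" if "fan vs" for vs
  proof -
    have "set vs \<subseteq> V" using that edges unfolding fan_def by fastforce
    then show ?thesis
      using that card_mono[OF finite_vertices, of "set vs"] distinct_card[of vs]
      unfolding fan_def by auto
  qed
  have "fan []" using uv \<open>u \<noteq> v\<close> unfolding fan_def by simp
  then obtain vs where vs: "fan vs" and vs_max: "\<And>us. fan us \<Longrightarrow> length us \<le> length vs"
    using ex_has_greatest_nat[of fan "[]" length "Suc (card V)"] fan_len
    by (auto simp: less_Suc_eq_le)
  let ?x = "last (v # vs)"
  have x: "?x \<in> set (v # vs)" by (rule last_in_set) simp
  then have "?x \<in> V" using vs edges unfolding fan_def by blast
  then obtain b where b: "b \<in> C" "missing F c ?x b" using miss by blast
  show ?thesis
  proof (cases "missing F c u b")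
    case True
    then show ?thesis
      using edge_colouring_rotate_fan[of E u v C c vs b] vs b col unfolding fan_def F_def by blast
  next
    case False
    obtain a where a: "a \<in> C" "missing F c u a" using miss \<open>u \<in> V\<close> by blast
    have "a \<noteq> b" using a False by auto
    obtain y where y: "{u, y} \<in> F" "c {u, y} = b"
      using F.partner_edge[OF False] by blast
    have "y \<noteq> v" using y unfolding F_def by auto
    have "y \<noteq> u" using F.edges[OF y(1)] by auto
    have y_only: "t = y" if "{u, t} \<in> F" "c {u, t} = b" for t
      using edge_colouringD[OF col that(1) y(1), of u] that y by (auto simp: doubleton_eq_iff)
    \<comment> \<open>The last fan vertex misses \<open>b\<close>, the colour of
      \<open>{u, y}\<close>, so otherwise \<open>y\<close> would prolong the fan.\<close>
    have "y \<in> set vs"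
    proof (rule ccontr)
      assume "y \<notin> set vs"
      have "fan (vs @ [y])"
        using vs b y \<open>y \<notin> set vs\<close> \<open>y \<noteq> v\<close> \<open>y \<noteq> u\<close>
        unfolding fan_def F_def
        by (simp add: successively_append_iff[of _ "v # vs" "[y]", simplified])
      then show False using vs_max by fastforce
    qed
    then obtain ps qs where split: "vs = ps @ y # qs" by (metis split_list)
    \<comment> \<open>As the predecessor of \<open>y\<close> in the fan, \<open>?p\<close> misses
      \<open>b\<close>, just like \<open>?x\<close>; the chain starting at \<open>u\<close> can
      contain only one of them.\<close>
    let ?p = "last (v # ps)"
    have p: "?p \<in> set (v # ps)" by (rule last_in_set) simp
    have succ: "successively (\<lambda>x y. missing F c x (c {u, y})) (v # ps)"
      "missing F c ?p b" "successively (\<lambda>x y. missing F c x (c {u, y})) (y # qs)"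
      using vs y(2) successively_append_iff[of _ "v # ps" "y # qs"] unfolding fan_def split by auto
    have "?x \<in> set (y # qs)" unfolding split by simp
    then have "?p \<noteq> ?x" using p vs unfolding fan_def split by (auto simp del: last.simps)
    obtain S where S: "u \<in> S" "?p \<notin> S \<or> ?x \<notin> S"
      and closed: "\<forall>e\<in>F. c e \<in> {a, b} \<longrightarrow> e \<subseteq> S \<or> e \<inter> S = {}"
      using F.kempe_chain[OF col \<open>u \<in> V\<close> a(2) succ(2) b(2) \<open>?p \<noteq> ?x\<close>] by metis
    txt \<open>After the swap \<open>u\<close> misses \<open>b\<close>, and one of two fans still ends in a vertex missing \<open>b\<close>: the
      one up to \<open>?p\<close> if \<open>?p\<close> is off the chain; otherwise the whole one, where \<open>?p\<close> now misses \<open>a\<close>,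
      the new colour of \<open>{u, y}\<close>.\<close>
    define c' where "c' = swap_colours S a b c"
    have col': "edge_colouring F C c'"
      unfolding c'_def by (rule edge_colouring_swap) (use closed col a b in auto)
    have miss': "missing F c' x (if x \<in> S then transpose a b i else i)" if "missing F c x i" for x i
      unfolding c'_def by (rule missing_swap) (use closed that in auto)
    have ub: "missing F c' u b" using miss'[OF a(2)] S(1) by simp
    \<comment> \<open>An edge at \<open>u\<close> other than \<open>{u, y}\<close> has neither
      colour \<open>b\<close>, used at \<open>u\<close> by \<open>{u, y}\<close> only, nor
      \<open>a\<close>, missing at \<open>u\<close>; so the swap preserves its fan
      condition.\<close>
    have step: "missing F c' s (c' {u, t})"
      if "missing F c s (c {u, t})" "t \<noteq> y" "{u, t} \<in> F" for s t
    proof -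
      have "c {u, t} \<noteq> b" using y_only that by blast
      moreover have "c {u, t} \<noteq> a" using a(2) that(3) unfolding missing_def by blast
      ultimately show ?thesis
        using miss'[OF that(1)] by (auto simp: c'_def swap_colours_def transpose_def split: if_splits)
    qed
    have inF: "{u, t} \<in> F" if "t \<in> set vs" for t
      using that vs unfolding fan_def F_def by (auto simp: doubleton_eq_iff)
    \<comment> \<open>The head of a segment is never the target of a step, so only the tail has to
      avoid \<open>y\<close>; this admits the segment starting at \<open>y\<close>.\<close>
    have succ': "successively (\<lambda>x y. missing F c' x (c' {u, y})) zs"
      if "successively (\<lambda>x y. missing F c x (c {u, y})) zs" "set (tl zs) \<subseteq> set vs - {y}" for zs
      using that
    proof (induction zs rule: induct_list012)
      case (3 s t zs)
      then show ?case using step inF by auto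
    qed auto
    have succ_ps: "successively (\<lambda>x y. missing F c' x (c' {u, y})) (v # ps)"
      by (rule succ'[OF succ(1)]) (use vs in \<open>auto simp: fan_def split\<close>)
    show ?thesis
    proof (cases "?p \<in> S")
      case False
      then have "missing F c' ?p b" using miss'[OF succ(2)] by simp
      then show ?thesis
        using edge_colouring_rotate_fan[of E u v C c' ps b] vs b(1) col' ub succ_ps
        unfolding fan_def F_def split by auto
    next
      case True
      have "c' {u, y} = a"
        using closed y S(1) unfolding c'_def swap_colours_def by auto
      then have "missing F c' ?p (c' {u, y})" using miss'[OF succ(2)] True by simp
      moreover have "successively (\<lambda>x y. missing F c' x (c' {u, y})) (y # qs)"
        by (rule succ'[OF succ(3)]) (use vs in \<open>auto simp: fan_def split\<close>)
      ultimately have "successively (\<lambda>x y. missing F c' x (c' {u, y})) (v # vs)"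
        using succ_ps successively_append_iff[of _ "v # ps" "y # qs"] unfolding split by auto
      moreover have "missing F c' ?x b" using miss'[OF b(2)] S(2) True by simp
      ultimately show ?thesis
        using edge_colouring_rotate_fan[of E u v C c' vs b] vs b(1) col' ub
        unfolding fan_def F_def by auto
    qed
  qed
qed

theorem (in simple_graph) Vizing:
  assumes "finite C" and deg: "\<And>x. x \<in> V \<Longrightarrow> degree E x < card C"
  shows "\<exists>c. edge_colouring E C c"
proof -
  have "\<exists>c. edge_colouring F C c" if "finite F" "F \<subseteq> E" for F
    using that
  proof (induction F rule: finite_induct)
    case empty
    show ?case by (simp add: edge_colouring_def)
  next
    case (insert e F)
    interpret F: simple_graph V "insert e F" using insert.prems by (rule subgraph)
    obtain c where c: "edge_colouring F C c" using insert by auto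
    obtain u v where e: "e = {u, v}"
      using edges[of e] insert.prems by (auto simp: card_2_iff)
    show ?case
    proof (rule F.edge_colouring_extend[OF assms(1)])
      show "degree (insert e F) x < card C" if "x \<in> V" for x
        using degree_mono[OF finite_edges insert.prems, of x] deg[OF that] by simp
      show "edge_colouring (insert e F - {{u, v}}) C c"
        using c insert.hyps e by simp
    qed (simp add: e)
  qed
  then show ?thesis using finite_edges by blast
qed

section \<open>Heavy matchings and the bisections they give\<close>

lemma sum_fibre_ge_average:
  fixes w :: "'e \<Rightarrow> real"
  assumes "finite C" "C \<noteq> {}" "finite E" "c ` E \<subseteq> C"
  shows "\<exists>i\<in>C. sum w E / card C \<le> (\<Sum>e | e \<in> E \<and> c e = i. w e)"
proof (rule ccontr)
  assume "\<not> ?thesis"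
  then have "(\<Sum>i\<in>C. \<Sum>e | e \<in> E \<and> c e = i. w e) < (\<Sum>i\<in>C. sum w E / card C)"
    using assms(1,2) by (intro sum_strict_mono) auto
  also have "\<dots> = sum w E" using assms(1,2) by simp
  also have "\<dots> = (\<Sum>i\<in>C. \<Sum>e | e \<in> E \<and> c e = i. w e)"
    using sum.group[OF assms(3,1,4), of w] by simp
  finally show False by simp
qed

text \<open>Summing over all of \<open>E\<close> allows different cuts to be compared edge by
  edge.\<close>

lemma bisection_weight_alt:
  assumes "finite E"
  shows "bisection_weight E w X Y =
    (\<Sum>e\<in>E. if \<exists>x\<in>X. \<exists>y\<in>Y. e = {x, y} then w e else 0)"
  unfolding bisection_weight_def cut_edges_def using assms
  by (simp add: sum.inter_filter)

text \<open>Both ways of placing \<open>x\<close> and \<open>y\<close> on opposite sides cut \<open>{x, y}\<close>, while every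
  other edge meeting \<open>{x, y}\<close> is cut by exactly one of them.\<close>

lemma (in simple_graph) bisection_weight_insert_pair:
  assumes XY: "X \<union> Y = V - {x, y}" "X \<inter> Y = {}" and xy: "x \<in> V" "y \<in> V" "x \<noteq> y"
  shows "bisection_weight E w (insert x X) (insert y Y) +
      bisection_weight E w (insert y X) (insert x Y) =
    2 * bisection_weight {e\<in>E. e \<inter> {x, y} = {}} w X Y +
      (\<Sum>e | e \<in> E \<and> e \<inter> {x, y} \<noteq> {}. w e) + (if {x, y} \<in> E then w {x, y} else 0)"
proof -
  let ?cut = "\<lambda>X Y e. if \<exists>x\<in>X. \<exists>y\<in>Y. e = {x, y} then w e else 0"
  \<comment> \<open>The edge \<open>{x, y}\<close> is cut both times: it is counted once among the
    edges meeting the pair and once more by the last summand.\<close>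
  have eq: "?cut (insert x X) (insert y Y) e + ?cut (insert y X) (insert x Y) e =
      (if e \<inter> {x, y} = {} then 2 * ?cut X Y e else 0) +
      (if e \<inter> {x, y} \<noteq> {} then w e else 0) + (if e = {x, y} then w e else 0)"
    if "e \<in> E" for e
  proof -
    have "card e = 2" "e \<subseteq> V" using edges[OF that] by auto
    then obtain p q where e: "e = {p, q}" "p \<noteq> q" "p \<in> V" "q \<in> V"
      by (auto simp: card_2_iff)
    have side: "z \<in> X \<and> z \<notin> Y \<or> z \<notin> X \<and> z \<in> Y" if "z \<in> V" "z \<noteq> x" "z \<noteq> y" for z
      using that XY by blast
    have no: "x \<notin> X" "x \<notin> Y" "y \<notin> X" "y \<notin> Y" using XY by auto
    have cut_iff: "(\<exists>x\<in>X. \<exists>y\<in>Y. e = {x, y}) \<longleftrightarrow> p \<in> X \<and> q \<in> Y \<or> q \<in> X \<and> p \<in> Y"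
      for X Y unfolding e by (auto simp: doubleton_eq_iff)
    have e_iff: "e = {x, y} \<longleftrightarrow> p = x \<and> q = y \<or> p = y \<and> q = x"
      unfolding e by (auto simp: doubleton_eq_iff)
    have meet_iff: "e \<inter> {x, y} = {} \<longleftrightarrow> p \<noteq> x \<and> p \<noteq> y \<and> q \<noteq> x \<and> q \<noteq> y"
      unfolding e by auto
    show ?thesis
      unfolding cut_iff e_iff meet_iff using side[of p] side[of q] no e(2-4) xy(3)
      by (cases "p = x"; cases "p = y"; cases "q = x"; cases "q = y") auto
  qed
  have fin: "finite {e\<in>E. e \<inter> {x, y} = {}}" using finite_edges by simp
  have "bisection_weight E w (insert x X) (insert y Y) +
      bisection_weight E w (insert y X) (insert x Y) =
    (\<Sum>e\<in>E. ?cut (insert x X) (insert y Y) e + ?cut (insert y X) (insert x Y) e)"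
    unfolding bisection_weight_alt[OF finite_edges] by (rule sum.distrib[symmetric])
  also have "\<dots> = (\<Sum>e\<in>E. (if e \<inter> {x, y} = {} then 2 * ?cut X Y e else 0)) +
      (\<Sum>e\<in>E. if e \<inter> {x, y} \<noteq> {} then w e else 0) + (\<Sum>e\<in>E. if e = {x, y} then w e else 0)"
    by (subst sum.cong[OF refl eq]) (simp_all only: sum.distrib)
  also have "(\<Sum>e\<in>E. (if e \<inter> {x, y} = {} then 2 * ?cut X Y e else 0)) =
      2 * bisection_weight {e\<in>E. e \<inter> {x, y} = {}} w X Y"
    unfolding bisection_weight_alt[OF fin]
    by (simp only: sum.inter_filter[OF finite_edges] sum_distrib_left) (rule sum.cong, auto)
  also have "(\<Sum>e\<in>E. if e \<inter> {x, y} \<noteq> {} then w e else 0) =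
      (\<Sum>e | e \<in> E \<and> e \<inter> {x, y} \<noteq> {}. w e)"
    using sum.inter_filter[OF finite_edges, of w] by simp
  also have "(\<Sum>e\<in>E. if e = {x, y} then w e else 0) = (if {x, y} \<in> E then w {x, y} else 0)"
    using sum.delta[OF finite_edges, of "{x, y}" w] by simp
  finally show ?thesis .
qed

lemma bisection_insert_pair:
  assumes "finite V" "bisection (V - {x, y}) X Y" "x \<in> V" "y \<in> V" "x \<noteq> y"
  shows "bisection V (insert x X) (insert y Y)"
proof -
  have u: "X \<union> Y = V - {x, y}" "X \<inter> Y = {}" using assms(2) unfolding bisection_def by auto
  then have "finite X" "finite Y" using assms(1) by (metis finite_Diff finite_Un)+
  moreover have "x \<notin> X" "y \<notin> Y" using u by auto
  ultimately have "card (insert x X) = Suc (card X)" "card (insert y Y) = Suc (card Y)" by auto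
  moreover have "insert x X \<union> insert y Y = V" "insert x X \<inter> insert y Y = {}"
    using u assms(3-5) by blast+
  ultimately show ?thesis using assms(2) unfolding bisection_def by simp
qed

text \<open>Induction removes two vertices at a time: the ends of an edge of \<open>M\<close> while
  there is one, and an arbitrary pair afterwards. Of the two ways to put the pair back on opposite
  sides, the better one reaches the average. With an odd number of vertices a single one remains at
  the end.\<close>

lemma bisection_of_matching:
  fixes w :: "'a set \<Rightarrow> real"
  assumes "weighted_graph V E w" and "M \<subseteq> E"
    and "\<And>e f. e \<in> M \<Longrightarrow> f \<in> M \<Longrightarrow> e \<inter> f \<noteq> {} \<Longrightarrow> e = f"
  shows "\<exists>X Y. bisection V X Y \<and> (sum w E + sum w M) / 2 \<le> bisection_weight E w X Y"
  using assms
proof (induction "card V" arbitrary: V E M rule: less_induct)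
  case less
  interpret weighted_graph V E w by fact
  have finM: "finite M" using less.prems(2) finite_edges finite_subset by blast
  show ?case
  proof (cases "card V \<le> 1")
    case True
    have "e \<notin> E" for e
      using edges[of e] card_mono[OF finite_vertices, of e] True by auto
    then have "E = {}" by blast
    moreover have "bisection V V {}" using True unfolding bisection_def by simp
    ultimately show ?thesis
      using less.prems(2) by (auto simp: bisection_weight_def cut_edges_def)
  next
    case False
    have "\<exists>x\<in>V. \<exists>y\<in>V. x \<noteq> y \<and> (M = {} \<or> {x, y} \<in> M)"
    proof (cases "M = {}")
      case True
      obtain x y where "x \<in> V" "y \<in> V" "x \<noteq> y"
        using False card_le_Suc0_iff_eq[OF finite_vertices] by auto
      then show ?thesis using True by blast
    next
      case False
      then obtain e where e: "e \<in> M" by blast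
      then obtain x y where "e = {x, y}" "x \<noteq> y" "e \<subseteq> V"
        using edges[OF subsetD[OF less.prems(2) e]] by (auto simp: card_2_iff)
      then show ?thesis using e by auto
    qed
    then obtain x y where xy: "x \<in> V" "y \<in> V" "x \<noteq> y" "M = {} \<or> {x, y} \<in> M" by blast
    define E' where "E' = {e\<in>E. e \<inter> {x, y} = {}}"
    define D where "D = {e\<in>E. e \<inter> {x, y} \<noteq> {}}"
    have sumE: "sum w E = sum w E' + sum w D"
      using sum.Int_Diff[OF finite_edges, of w E'] unfolding E'_def D_def
      by (auto intro!: arg_cong2[where f = "(+)"] sum.cong)
    have M_rest: "e \<inter> {x, y} = {}" if "e \<in> M - {{x, y}}" for e
      using less.prems(3)[of e "{x, y}"] xy(4) that by auto
    have wg: "weighted_graph (V - {x, y}) E' w"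
      using finite_vertices edges weight_nonneg
      by unfold_locales (auto simp: E'_def)
    obtain X Y where b: "bisection (V - {x, y}) X Y"
      and wt: "(sum w E' + sum w (M - {{x, y}})) / 2 \<le> bisection_weight E' w X Y"
    proof -
      have "card (V - {x, y}) < card V"
        by (rule psubset_card_mono) (use finite_vertices xy in auto)
      moreover have "M - {{x, y}} \<subseteq> E'" using M_rest less.prems(2) unfolding E'_def by auto
      ultimately show thesis using less.hyps[OF _ wg, of "M - {{x, y}}"] less.prems(3) that by blast
    qed
    \<comment> \<open>Equality can fail when \<open>M\<close> is empty, since the arbitrary pair may
      happen to be an edge.\<close>
    have sumM: "sum w M \<le> sum w (M - {{x, y}}) + (if {x, y} \<in> E then w {x, y} else 0)"
      using xy(4) less.prems(2) sum.remove[OF finM, of "{x, y}" w] weight_nonneg[of "{x, y}"] by auto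
    have XY: "X \<union> Y = V - {x, y}" "X \<inter> Y = {}" using b unfolding bisection_def by auto
    have "sum w E + sum w M \<le> bisection_weight E w (insert x X) (insert y Y) +
        bisection_weight E w (insert y X) (insert x Y)"
      unfolding bisection_weight_insert_pair[OF XY xy(1-3), of w]
      using sumE sumM wt unfolding E'_def[symmetric] D_def[symmetric] by (simp add: field_simps)
    moreover have "s / 2 \<le> p \<or> s / 2 \<le> q" if "s \<le> p + q" for s p q :: real
      using that by (auto simp: field_simps)
    ultimately have "(sum w E + sum w M) / 2 \<le> bisection_weight E w (insert x X) (insert y Y) \<or>
        (sum w E + sum w M) / 2 \<le> bisection_weight E w (insert y X) (insert x Y)"
      by blast
    then show ?thesis
    proof
      assume "(sum w E + sum w M) / 2 \<le> bisection_weight E w (insert x X) (insert y Y)"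
      then show ?thesis
        using bisection_insert_pair[OF finite_vertices b xy(1-3)] by blast
    next
      assume "(sum w E + sum w M) / 2 \<le> bisection_weight E w (insert y X) (insert x Y)"
      moreover have "bisection V (insert y X) (insert x Y)"
        using b xy finite_vertices by (intro bisection_insert_pair) (auto simp: insert_commute)
      ultimately show ?thesis by blast
    qed
  qed
qed

theorem corollary2p7:
  fixes V :: "'a set" and E :: "'a set set" and w :: "'a set \<Rightarrow> real" and k :: nat
  assumes "k \<ge> 1"
    and "weighted_graph V E w"
    and "max_degree V E \<le> k"
  shows "\<exists>X Y. bisection V X Y \<and>
           bisection_weight E w X Y \<ge>
             (real k + 2) / (2 * (real k + 1)) * total_weight E w"
proof -
  interpret weighted_graph V E w by fact
  \<comment> \<open>The palette \<open>{..k}\<close> has \<open>k + 1\<close> colours, which makes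
    the inequality strict.\<close>
  have "degree E x < card {..k}" if "x \<in> V" for x
    using assms(3) that finite_vertices unfolding max_degree_def by (auto simp: Max_le_iff)
  then obtain c where c: "edge_colouring E {..k} c"
    using Vizing[of "{..k}"] by blast
  then have "c ` E \<subseteq> {..k}" unfolding edge_colouring_def by blast
  then obtain i where i: "sum w E / card {..k} \<le> (\<Sum>e | e \<in> E \<and> c e = i. w e)"
    using sum_fibre_ge_average[of "{..k}" E c w] finite_edges by auto
  let ?M = "{e. e \<in> E \<and> c e = i}"
  \<comment> \<open>A colour class of a proper colouring is a matching.\<close>
  have "e = f" if "e \<in> ?M" "f \<in> ?M" "e \<inter> f \<noteq> {}" for e f
    using edge_colouringD[OF c, of e f] that by auto
  then obtain X Y where XY: "bisection V X Y"
    "(sum w E + sum w ?M) / 2 \<le> bisection_weight E w X Y"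
    using bisection_of_matching[OF assms(2), of ?M] by auto
  \<comment> \<open>The constant is half of \<open>1 + 1 / (k + 1)\<close>.\<close>
  have "(real k + 2) / (2 * (real k + 1)) * total_weight E w = (sum w E + sum w E / card {..k}) / 2"
    unfolding total_weight_def by (simp add: field_simps)
  also have "\<dots> \<le> bisection_weight E w X Y" using i XY(2) by simp
  finally show ?thesis using XY(1) by blast
qed

end
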